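(* Let $G=G_{n,1/2}$ and let $X_n$ be the number of unordered partitions of $V(G)$ into two sets $\{A,B\}$ such that $G[A]$ and $G[B]$ both have all degrees even. Then for $0\le k\le n-1$, $$\Pr(X_n=2^k)=2^{-\binom n2}\prod_{i=1}^{\lfloor (n-1-k)/2\rfloor}(1-2^{-2i})^{-1}\prod_{i=k+1}^{n-1}(2^i-1),$$ and $\Pr(X_n=x)=0$ if $x\neq 2^k$ for every such $k$.
   Context: $G_{n,1/2}$ is the binomial random graph on vertex set $[n]$ with each edge present independently with probability $1/2$. Empty products equal $1$. *)

theory Defs
  imports "HOL-Probability.Probability" "HOL-Probability.Product_PMF"
begin

text \<open>A simple graph is given by its vertex set \<open>V\<close> together with its edge set, a set of
  two-element subsets of \<open>V\<close>.\<close>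

type_synonym 'a edges = "'a set set"

definition all_pairs :: "'a set \<Rightarrow> 'a edges" where
  "all_pairs V = {e. e \<subseteq> V \<and> card e = 2}"

definition induced_edges :: "'a edges \<Rightarrow> 'a set \<Rightarrow> 'a edges" where
  "induced_edges E A = {e \<in> E. e \<subseteq> A}"

definition degree_in :: "'a edges \<Rightarrow> 'a \<Rightarrow> nat" where
  "degree_in E v = card {e \<in> E. v \<in> e}"

definition induces_even :: "'a edges \<Rightarrow> 'a set \<Rightarrow> bool" where
  "induces_even E A \<longleftrightarrow> (\<forall>v\<in>A. even (degree_in (induced_edges E A) v))"

text \<open>Unordered partitions are represented as sets \<open>{A, B}\<close>. One part may be empty, so
  \<open>{V, {}}\<close> is counted when all degrees of the whole graph are even.\<close>

definition even_partitions :: "'a set \<Rightarrow> 'a edges \<Rightarrow> 'a set set set" where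
  "even_partitions V E =
     {{A, B} | A B. A \<union> B = V \<and> A \<inter> B = {} \<and> induces_even E A \<and> induces_even E B}"

definition num_even_partitions :: "'a set \<Rightarrow> 'a edges \<Rightarrow> nat" where
  "num_even_partitions V E = card (even_partitions V E)"

text \<open>The law of the edge set of the binomial random graph: independent Bernoulli
  indicators, one for each pair of vertices. The argument \<open>False\<close> is only the
  value of the indicator function outside the set of pairs.\<close>

definition binomial_random_graph :: "nat \<Rightarrow> real \<Rightarrow> nat edges pmf" where
  "binomial_random_graph n p =
     map_pmf (\<lambda>f. {e \<in> all_pairs {1..n}. f e})
       (Pi_pmf (all_pairs {1..n}) False (\<lambda>_. bernoulli_pmf p))"

end

theory Submission
  imports Defs
begin

text \<open>Over the two-element field, a set with characteristic vector \<open>x\<close> is one side of an even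
  partition iff \<open>L x = d\<close>, where \<open>L\<close> is the Laplacian and \<open>d\<close> the degree vector, which is also the
  diagonal of \<open>L\<close>. Normalising \<open>x\<close> to vanish at one vertex and deleting the row and column of that
  vertex gives \<open>M y = diag M\<close> for a uniformly random symmetric matrix \<open>M\<close> of size \<open>n - 1\<close>. This
  system is always solvable, so \<open>X\<^sub>n\<close> is the size of the kernel of \<open>M\<close>.

  The corank distribution comes from bordering a matrix \<open>M\<close> of size \<open>m\<close> and corank \<open>k\<close> by a row
  \<open>v\<close> and a diagonal entry \<open>a\<close>. If \<open>v\<close> is outside the image of \<open>M\<close>, the corank drops by 1; if
  \<open>v\<close> is one of the \<open>2\<^bsup>m - k\<^esup>\<close> vectors in the image, one value of \<open>a\<close> raises the corank by 1 and
  the other preserves it. The product formula satisfies the resulting recursion.\<close>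

section \<open>Linear algebra of symmetric matrices over the two-element field, by counting\<close>

definition nbhd :: "'a edges \<Rightarrow> 'a \<Rightarrow> 'a set" where
  "nbhd S v = {u. {u, v} \<in> S}"

text \<open>A symmetric matrix over the two-element field with index set \<open>V\<close> is encoded by the set of
  all \<open>{u, v}\<close> whose entry at \<open>(u, v)\<close> is 1, where \<open>u = v\<close> is allowed; a vector is encoded by
  its support.\<close>

definition loop_pairs :: "'a set \<Rightarrow> 'a edges" where
  "loop_pairs V = {e. e \<subseteq> V \<and> (card e = 1 \<or> card e = 2)}"

text \<open>This is the matrix-vector product; \<open>loops\<close> below is the diagonal of the
  matrix, read as a vector.\<close>

definition mat_image :: "'a set \<Rightarrow> 'a edges \<Rightarrow> 'a set \<Rightarrow> 'a set" where
  "mat_image V S X = {v \<in> V. odd (card (X \<inter> nbhd S v))}"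

definition mat_kernel :: "'a set \<Rightarrow> 'a edges \<Rightarrow> 'a set set" where
  "mat_kernel V S = {X. X \<subseteq> V \<and> mat_image V S X = {}}"

definition loops :: "'a set \<Rightarrow> 'a edges \<Rightarrow> 'a set" where
  "loops V S = {v \<in> V. {v} \<in> S}"

text \<open>Symmetric difference is vector addition and the parity of an intersection is the dot
  product, so this is additivity of the dot product.\<close>

lemma even_card_sym_diff_Int:
  assumes "finite X" "finite Y"
  shows "even (card (sym_diff X Y \<inter> N)) \<longleftrightarrow> (even (card (X \<inter> N)) \<longleftrightarrow> even (card (Y \<inter> N)))"
proof -
  have e: "X \<inter> N = ((X - Y) \<inter> N) \<union> (X \<inter> Y \<inter> N)" "Y \<inter> N = ((Y - X) \<inter> N) \<union> (X \<inter> Y \<inter> N)"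
     "sym_diff X Y \<inter> N = ((X - Y) \<inter> N) \<union> ((Y - X) \<inter> N)" by auto
  have "card (X \<inter> N) = card ((X - Y) \<inter> N) + card (X \<inter> Y \<inter> N)"
    using assms by (subst e(1), intro card_Un_disjoint) auto
  moreover have "card (Y \<inter> N) = card ((Y - X) \<inter> N) + card (X \<inter> Y \<inter> N)"
    using assms by (subst e(2), intro card_Un_disjoint) auto
  moreover have "card (sym_diff X Y \<inter> N) = card ((X - Y) \<inter> N) + card ((Y - X) \<inter> N)"
    using assms by (subst e(3), intro card_Un_disjoint) auto
  ultimately show ?thesis by auto
qed

text \<open>Adding the fixed odd member \<open>X0\<close> is an involution of \<open>K\<close> that
  exchanges even and odd members.\<close>

lemma card_half_even:
  assumes fin: "finite K" "\<And>X. X \<in> K \<Longrightarrow> finite X"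
    and closed: "\<And>X Y. X \<in> K \<Longrightarrow> Y \<in> K \<Longrightarrow> sym_diff X Y \<in> K"
    and X0: "X0 \<in> K" "odd (card (X0 \<inter> N))"
  shows "2 * card {X \<in> K. even (card (X \<inter> N))} = card K"
proof -
  let ?E = "{X \<in> K. even (card (X \<inter> N))}" and ?O = "{X \<in> K. odd (card (X \<inter> N))}"
  have "bij_betw (\<lambda>X. sym_diff X X0) ?E ?O"
  proof (rule bij_betw_byWitness[where f' = "\<lambda>X. sym_diff X X0"])
    show "(\<lambda>X. sym_diff X X0) ` ?E \<subseteq> ?O" "(\<lambda>X. sym_diff X X0) ` ?O \<subseteq> ?E"
      using X0 fin closed by (auto simp: even_card_sym_diff_Int)
  qed auto
  then have "card ?E = card ?O" by (rule bij_betw_same_card)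
  moreover have "card K = card ?E + card ?O"
    using fin(1) by (subst card_Un_disjoint[symmetric]) (auto intro!: arg_cong[where f = card])
  ultimately show ?thesis by simp
qed

text \<open>Counts a subspace against its orthogonal complement without bases. The pairs
  \<open>(N, X)\<close> with even intersection are counted twice: a vector \<open>N\<close> is
  orthogonal to all of \<open>K\<close> or to exactly half of it, and a nonempty \<open>X\<close> is
  orthogonal to exactly half of all \<open>N\<close>.\<close>

lemma card_perp:
  assumes V: "finite V" and K: "K \<subseteq> Pow V" "{} \<in> K"
    and closed: "\<And>X Y. X \<in> K \<Longrightarrow> Y \<in> K \<Longrightarrow> sym_diff X Y \<in> K"
  shows "card K * card {N. N \<subseteq> V \<and> (\<forall>X\<in>K. even (card (X \<inter> N)))} = 2 ^ card V"
proof -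
  let ?P = "{N. N \<subseteq> V \<and> (\<forall>X\<in>K. even (card (X \<inter> N)))}"
  have finK: "finite K" using V K(1) by (simp add: finite_subset)
  have finX: "finite X" if "X \<in> K" for X using that K(1) V by (auto intro: finite_subset)
  have PV: "?P \<subseteq> Pow V" by auto
  have finP: "finite ?P" using V PV by (simp add: finite_subset)
  have 1: "2 * card {X \<in> K. even (card (X \<inter> N))} = card K + of_bool (N \<in> ?P) * card K" if N: "N \<in> Pow V" for N
  proof (cases "N \<in> ?P")
    case True
    then have "{X \<in> K. even (card (X \<inter> N))} = K" by auto
    then show ?thesis using True by simp
  next
    case False
    then obtain X0 where "X0 \<in> K" "odd (card (X0 \<inter> N))" using N by auto
    from card_half_even[OF finK finX closed this] False show ?thesis by simp
  qed
  have 2: "2 * card {N \<in> Pow V. even (card (X \<inter> N))} = 2 ^ card V + of_bool (X = {}) * 2 ^ card V"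
    if X: "X \<in> K" for X
  proof (cases "X = {}")
    case True
    have "{N. N \<subseteq> V} = Pow V" by auto
    then show ?thesis using True V by (simp add: card_Pow)
  next
    case False
    then obtain x where x: "x \<in> X" by auto
    have "2 * card {N \<in> Pow V. even (card (N \<inter> X))} = card (Pow V)"
      by (rule card_half_even[of _ "{x}"]) (use V K(1) X x in \<open>auto intro: finite_subset\<close>)
    then show ?thesis using False V by (simp add: card_Pow Int_commute)
  qed
  have "(\<Sum>N\<in>Pow V. card {X \<in> K. even (card (X \<inter> N))}) = (\<Sum>X\<in>K. card {N \<in> Pow V. even (card (X \<inter> N))})"
    using V finK by (intro sum_multicount_gen) auto
  then have e: "(\<Sum>N\<in>Pow V. 2 * card {X \<in> K. even (card (X \<inter> N))}) = (\<Sum>X\<in>K. 2 * card {N \<in> Pow V. even (card (X \<inter> N))})"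
    by (simp add: sum_distrib_left[symmetric])
  have "(\<Sum>N\<in>Pow V. card K + of_bool (N \<in> ?P) * card K) = (\<Sum>N\<in>Pow V. 2 * card {X \<in> K. even (card (X \<inter> N))})"
    by (intro sum.cong refl 1[symmetric])
  also note e
  also have "(\<Sum>X\<in>K. 2 * card {N \<in> Pow V. even (card (X \<inter> N))}) = (\<Sum>X\<in>K. 2 ^ card V + of_bool (X = {}) * 2 ^ card V)"
    by (intro sum.cong refl 2)
  finally have both: "(\<Sum>N\<in>Pow V. card K + of_bool (N \<in> ?P) * card K) = (\<Sum>X\<in>K. 2 ^ card V + of_bool (X = {}) * 2 ^ card V)" .
  have lhs: "(\<Sum>N\<in>Pow V. card K + of_bool (N \<in> ?P) * card K) = 2 ^ card V * card K + card ?P * card K"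
  proof -
    have "Pow V \<inter> ?P = ?P" by auto
    then show ?thesis
      using V by (simp only: sum.distrib sum_distrib_right[symmetric] sum_of_bool_eq finite_Pow_iff sum_constant)
         (simp add: card_Pow)
  qed
  have rhs: "(\<Sum>X\<in>K. 2 ^ card V + of_bool (X = {}) * 2 ^ card V) = card K * 2 ^ card V + (2 ^ card V :: nat)"
  proof -
    have "K \<inter> {{}} = {{}}" using K(2) by auto
    then show ?thesis
      using finK by (simp add: sum.distrib sum_distrib_right[symmetric] sum_of_bool_eq)
  qed
  have "a * c + p * c = c * a + a \<Longrightarrow> c * p = a" for a c p :: nat
    by (simp add: mult.commute)
  from this[OF trans[OF trans[OF lhs[symmetric] both] rhs]] show ?thesis .
qed

text \<open>The sum on the right is, modulo 2, the bilinear form of the matrix at \<open>X\<close>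
  and \<open>Y\<close>.\<close>

lemma even_card_mat_image_Int:
  assumes "finite V" "Y \<subseteq> V"
  shows "even (card (mat_image V S X \<inter> Y)) \<longleftrightarrow> even (\<Sum>v\<in>Y. card (X \<inter> nbhd S v))"
proof -
  have "mat_image V S X \<inter> Y = {v \<in> Y. odd (card (X \<inter> nbhd S v))}"
    using assms by (auto simp: mat_image_def)
  then show ?thesis using assms finite_subset[of Y V] by (simp add: even_sum_iff)
qed

lemma sum_card_nbhd_commute:
  assumes "finite X" "finite Y"
  shows "(\<Sum>v\<in>Y. card (X \<inter> nbhd S v)) = (\<Sum>v\<in>X. card (Y \<inter> nbhd S v))"
proof -
  have "(\<Sum>v\<in>Y. card {u \<in> X. {u, v} \<in> S}) = (\<Sum>u\<in>X. card {v \<in> Y. {u, v} \<in> S})"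
    using assms by (intro sum_multicount_gen) auto
  then show ?thesis by (simp add: nbhd_def Int_def insert_commute)
qed

text \<open>Entries are indexed by unordered sets \<open>{u, v}\<close>, so the bilinear form is
  symmetric and the matrix is self-adjoint.\<close>

lemma mat_image_adjoint:
  assumes "finite V" "X \<subseteq> V" "Y \<subseteq> V"
  shows "even (card (mat_image V S X \<inter> Y)) \<longleftrightarrow> even (card (X \<inter> mat_image V S Y))"
proof -
  have "finite X" "finite Y" using assms by (auto intro: finite_subset)
  then have "(\<Sum>v\<in>Y. card (X \<inter> nbhd S v)) = (\<Sum>v\<in>X. card (Y \<inter> nbhd S v))"
    by (rule sum_card_nbhd_commute)
  then show ?thesis
    unfolding Int_commute[of X "mat_image V S Y"] even_card_mat_image_Int[OF assms(1,3)]
      even_card_mat_image_Int[OF assms(1,2)] by (rule arg_cong)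
qed

text \<open>In the quadratic form each off-diagonal entry occurs twice and cancels modulo 2; only
  the diagonal survives. For a loopless graph this is the handshake lemma.\<close>

lemma even_sum_card_nbhd:
  assumes "finite X"
  shows "even (\<Sum>v\<in>X. card (X \<inter> nbhd S v)) \<longleftrightarrow> even (card (loops X S))"
  using assms
proof (induction X)
  case empty
  then show ?case by (simp add: loops_def)
next
  case (insert x X)
  have c: "card (insert x X \<inter> nbhd S v) = card (X \<inter> nbhd S v) + of_bool (v \<in> nbhd S x)" for v
    using insert.hyps by (auto simp: nbhd_def insert_commute)
  have "(\<Sum>v\<in>insert x X. card (insert x X \<inter> nbhd S v)) =
      (\<Sum>v\<in>X. card (X \<inter> nbhd S v)) + 2 * card (X \<inter> nbhd S x) + of_bool ({x} \<in> S)"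
    using insert.hyps by (simp add: c sum.distrib sum_of_bool_eq) (simp add: nbhd_def)
  moreover have "card (loops (insert x X) S) = card (loops X S) + of_bool ({x} \<in> S)"
  proof -
    have "loops (insert x X) S = (if {x} \<in> S then insert x (loops X S) else loops X S)"
      by (auto simp: loops_def)
    moreover have "x \<notin> loops X S" "finite (loops X S)" using insert.hyps by (auto simp: loops_def)
    ultimately show ?thesis by simp
  qed
  ultimately show ?case using insert.IH by simp
qed

lemma mat_image_sym_diff:
  assumes "finite X" "finite Y"
  shows "mat_image V S (sym_diff X Y) = sym_diff (mat_image V S X) (mat_image V S Y)"
  using even_card_sym_diff_Int[OF assms] by (auto simp: mat_image_def)

context
  fixes V :: "'a set" and S :: "'a edges"
  assumes finV: "finite V"
begin

lemma mat_kernel_closed: "X \<in> mat_kernel V S \<Longrightarrow> Y \<in> mat_kernel V S \<Longrightarrow> sym_diff X Y \<in> mat_kernel V S"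
  using finV finite_subset[of _ V] by (auto simp: mat_kernel_def mat_image_sym_diff)

lemma empty_in_mat_kernel: "{} \<in> mat_kernel V S"
  by (auto simp: mat_kernel_def mat_image_def)

lemma finite_mat_kernel: "finite (mat_kernel V S)"
  by (rule finite_subset[of _ "Pow V"]) (use finV in \<open>auto simp: mat_kernel_def\<close>)

text \<open>A nonempty fibre is a coset of the kernel, and adding \<open>Y0\<close> translates one
  to the other.\<close>

lemma card_mat_fibre:
  assumes Y0: "Y0 \<subseteq> V" "mat_image V S Y0 = N"
  shows "card {Y. Y \<subseteq> V \<and> mat_image V S Y = N} = card (mat_kernel V S)"
proof (rule bij_betw_same_card[OF bij_betw_byWitness[where f' = "\<lambda>X. sym_diff X Y0"]])
  show "(\<lambda>X. sym_diff X Y0) ` {Y. Y \<subseteq> V \<and> mat_image V S Y = N} \<subseteq> mat_kernel V S"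
       "(\<lambda>X. sym_diff X Y0) ` mat_kernel V S \<subseteq> {Y. Y \<subseteq> V \<and> mat_image V S Y = N}"
    using Y0 finV finite_subset[of _ V] by (auto simp: mat_kernel_def mat_image_sym_diff)
qed auto

text \<open>Rank-nullity in multiplicative form: \<open>Pow V\<close> is partitioned into fibres of
  equal size.\<close>

lemma card_kernel_times_card_image:
  "card (mat_kernel V S) * card (mat_image V S ` Pow V) = 2 ^ card V"
proof -
  have "card (Pow V) = (\<Sum>N\<in>mat_image V S ` Pow V. card {Y. Y \<in> Pow V \<and> mat_image V S Y = N})"
    unfolding card_eq_sum using finV by (intro sum.image_gen) simp
  also have "\<dots> = (\<Sum>N\<in>mat_image V S ` Pow V. card (mat_kernel V S))"
    by (intro sum.cong refl, elim imageE) (simp only: card_mat_fibre Pow_iff)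
  finally show ?thesis using finV by (simp add: card_Pow mult.commute)
qed

text \<open>Self-adjointness puts the image inside the orthogonal complement of the kernel.
  Rank-nullity and \<open>card_perp\<close> give both sets the same cardinality, so they
  coincide.\<close>

lemma range_mat_image:
  "mat_image V S ` Pow V = {N. N \<subseteq> V \<and> (\<forall>X\<in>mat_kernel V S. even (card (X \<inter> N)))}" (is "?I = ?P")
proof (rule card_subset_eq)
  show "finite ?P" using finV by simp
  show "?I \<subseteq> ?P"
  proof clarify
    fix Y assume Y: "Y \<subseteq> V"
    have "even (card (X \<inter> mat_image V S Y))" if "X \<in> mat_kernel V S" for X
      using that Y finV mat_image_adjoint[of V X Y S] by (simp add: mat_kernel_def)
    then show "mat_image V S Y \<subseteq> V \<and> (\<forall>X\<in>mat_kernel V S. even (card (X \<inter> mat_image V S Y)))"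
      by (auto simp: mat_image_def)
  qed
  have "card (mat_kernel V S) * card ?P = 2 ^ card V"
    using mat_kernel_closed empty_in_mat_kernel
    by (intro card_perp[OF finV]) (auto simp: mat_kernel_def)
  moreover have "card (mat_kernel V S) \<noteq> 0"
    using finite_mat_kernel empty_in_mat_kernel by auto
  moreover note card_kernel_times_card_image
  moreover have "c \<noteq> 0 \<Longrightarrow> c * p = d \<Longrightarrow> c * i = d \<Longrightarrow> i = p" for c d i p :: nat
    by (metis mult_left_cancel)
  ultimately show "card ?I = card ?P" by blast
qed

lemma card_mat_kernel_power_of_2:
  obtains k where "k \<le> card V" "card (mat_kernel V S) = 2 ^ k"
proof -
  have "card (mat_kernel V S) dvd 2 ^ card V"
    using card_kernel_times_card_image by (metis dvd_triv_left)
  then obtain k where "k \<le> card V" "card (mat_kernel V S) = 2 ^ k"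
    unfolding divides_primepow_nat[OF two_is_prime_nat] by blast
  then show ?thesis by (rule that)
qed

text \<open>The system \<open>M y = diag M\<close> is always solvable: for \<open>M x = 0\<close> one has
  \<open>x\<^sup>T diag M = x\<^sup>T M x = 0\<close> over the two-element field, so the diagonal is orthogonal to the
  kernel and hence lies in the image.\<close>
lemma card_solutions_loops:
  "card {Y. Y \<subseteq> V \<and> mat_image V S Y = loops V S} = card (mat_kernel V S)"
proof -
  have "even (card (X \<inter> loops V S))" if X: "X \<in> mat_kernel V S" for X
  proof -
    have XV: "X \<subseteq> V" "finite X" using X finV by (auto simp: mat_kernel_def intro: finite_subset)
    have "even (\<Sum>v\<in>X. card (X \<inter> nbhd S v))"
      using X XV(1) by (intro dvd_sum) (auto simp: mat_kernel_def mat_image_def)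
    moreover have "loops X S = X \<inter> loops V S" using XV by (auto simp: loops_def)
    ultimately show ?thesis using even_sum_card_nbhd[OF XV(2)] by simp
  qed
  then have "loops V S \<in> mat_image V S ` Pow V"
    by (subst range_mat_image) (auto simp: loops_def)
  then obtain Y0 where "Y0 \<subseteq> V" "mat_image V S Y0 = loops V S" by fastforce
  then show ?thesis by (rule card_mat_fibre)
qed

end

section \<open>Change of the kernel size when a symmetric matrix is bordered by one row\<close>

text \<open>\<open>N\<close> is the support of the new row, including its diagonal entry at \<open>w\<close>.\<close>

definition add_row :: "'a \<Rightarrow> 'a edges \<Rightarrow> 'a set \<Rightarrow> 'a edges" where
  "add_row w S N = S \<union> (\<lambda>u. {u, w}) ` N"

lemma bij_betw_add_row:
  assumes w: "w \<notin> V"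
  shows "bij_betw (\<lambda>(S, N). add_row w S N) (Pow (loop_pairs V) \<times> Pow (insert w V))
    (Pow (loop_pairs (insert w V)))"
\<comment> \<open>The inverse separates the entries avoiding \<open>w\<close> from the row at
  \<open>w\<close>; the diagonal entry is the case \<open>u = w\<close>, since
  \<open>{w, w} = {w}\<close>.\<close>
proof (rule bij_betw_byWitness[where f' = "\<lambda>S. ({e \<in> S. w \<notin> e}, {u. {u, w} \<in> S})"])
  show "\<forall>p\<in>Pow (loop_pairs V) \<times> Pow (insert w V).
      (\<lambda>S. ({e \<in> S. w \<notin> e}, {u. {u, w} \<in> S})) ((\<lambda>(S, N). add_row w S N) p) = p"
    using w by (auto simp: add_row_def loop_pairs_def doubleton_eq_iff)
  show "\<forall>S\<in>Pow (loop_pairs (insert w V)).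
      (\<lambda>(S, N). add_row w S N) ({e \<in> S. w \<notin> e}, {u. {u, w} \<in> S}) = S"
  proof
    fix S assume S: "S \<in> Pow (loop_pairs (insert w V))"
    have "e \<in> (\<lambda>u. {u, w}) ` {u. {u, w} \<in> S}" if e: "e \<in> S" "w \<in> e" for e
    proof -
      have "card e = 1 \<or> card e = 2" using S e by (auto simp: loop_pairs_def)
      then obtain u where "e = {u, w}"
        using e(2) by (auto simp: card_1_singleton_iff card_2_iff)
      then show ?thesis using e by auto
    qed
    then show "(\<lambda>(S, N). add_row w S N) ({e \<in> S. w \<notin> e}, {u. {u, w} \<in> S}) = S"
      by (auto simp: add_row_def)
  qed
  show "(\<lambda>(S, N). add_row w S N) ` (Pow (loop_pairs V) \<times> Pow (insert w V)) \<subseteq> Pow (loop_pairs (insert w V))"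
    by (auto simp: add_row_def loop_pairs_def card_insert_if split: if_splits)
  show "(\<lambda>S. ({e \<in> S. w \<notin> e}, {u. {u, w} \<in> S})) ` Pow (loop_pairs (insert w V))
      \<subseteq> Pow (loop_pairs V) \<times> Pow (insert w V)"
    by (auto simp: loop_pairs_def)
qed

lemma finite_loop_pairs: "finite V \<Longrightarrow> finite (loop_pairs V)"
  by (rule finite_subset[of _ "Pow V"]) (auto simp: loop_pairs_def)

context
  fixes V :: "'a set" and S :: "'a edges" and w :: 'a
  assumes finV: "finite V" and S: "S \<subseteq> loop_pairs V" and w: "w \<notin> V"
begin

lemma nbhd_add_row:
  assumes "N \<subseteq> insert w V"
  shows "v \<in> V \<Longrightarrow> nbhd (add_row w S N) v = (if v \<in> N then insert w (nbhd S v) else nbhd S v)"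
    and "nbhd (add_row w S N) w = N"
  using w S assms by (auto simp: nbhd_def add_row_def doubleton_eq_iff loop_pairs_def)

lemma notin_nbhd: "w \<notin> nbhd S v"
  using w S by (auto simp: nbhd_def loop_pairs_def)

text \<open>Kernel vectors are split by their coordinate at \<open>w\<close>. If it is 0, the old
  rows ask for a kernel vector of \<open>S\<close> and the new row for orthogonality to
  \<open>N\<close>. If it is 1, the old rows become an inhomogeneous system with right-hand side
  \<open>N - {w}\<close>, and the new row adds the diagonal entry to the parity.\<close>

lemma card_mat_kernel_add_row:
  assumes N: "N \<subseteq> insert w V"
  shows "card (mat_kernel (insert w V) (add_row w S N)) =
    card {X \<in> mat_kernel V S. even (card (X \<inter> N))} +
    card {Y. Y \<subseteq> V \<and> mat_image V S Y = N - {w} \<and> (even (card (Y \<inter> N)) \<longleftrightarrow> w \<notin> N)}"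
    (is "card ?K = card ?X + card ?Y")
proof -
  have image: "mat_image (insert w V) (add_row w S N) X = {} \<longleftrightarrow>
      even (card (X \<inter> N)) \<and> (\<forall>v\<in>V. even (card (X \<inter> nbhd (add_row w S N) v)))" for X
    using nbhd_add_row(2)[OF N] by (auto simp: mat_image_def)
  have notin: "Y \<inter> nbhd (add_row w S N) v = Y \<inter> nbhd S v" if "Y \<subseteq> V" "v \<in> V" for Y v
    using that w nbhd_add_row(1)[OF N] by auto
  have with_w: "insert w Y \<inter> nbhd (add_row w S N) v =
      (if v \<in> N then insert w (Y \<inter> nbhd S v) else Y \<inter> nbhd S v)" if "Y \<subseteq> V" "v \<in> V" for Y v
    using that w nbhd_add_row(1)[OF N] notin_nbhd[of v] by auto
  have 1: "X \<in> ?K \<longleftrightarrow> X \<in> ?X" if "X \<subseteq> V" for X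
    using that image[of X] notin[of X] by (auto simp: mat_kernel_def mat_image_def)
  have 2: "insert w Y \<in> ?K \<longleftrightarrow> Y \<in> ?Y" if Y: "Y \<subseteq> V" for Y
  proof -
    have fY: "finite Y" "w \<notin> Y" using Y finV w by (auto intro: finite_subset)
    have "even (card (insert w Y \<inter> nbhd (add_row w S N) v)) \<longleftrightarrow>
        (v \<in> N \<longleftrightarrow> odd (card (Y \<inter> nbhd S v)))" if "v \<in> V" for v
      using with_w[OF Y that] fY by auto
    moreover have "even (card (insert w Y \<inter> N)) \<longleftrightarrow> (even (card (Y \<inter> N)) \<longleftrightarrow> w \<notin> N)"
      using fY by (auto simp: Int_insert_left)
    moreover have "mat_image V S Y = N - {w} \<longleftrightarrow> (\<forall>v\<in>V. v \<in> N \<longleftrightarrow> odd (card (Y \<inter> nbhd S v)))"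
      using N w by (auto simp: mat_image_def)
    ultimately show ?thesis
      using Y image[of "insert w Y"] by (auto simp: mat_kernel_def)
  qed
  have "?K = ?X \<union> insert w ` ?Y"
  proof (rule set_eqI)
    fix X
    show "X \<in> ?K \<longleftrightarrow> X \<in> ?X \<union> insert w ` ?Y"
    proof (cases "w \<in> X")
      case True
      have "X \<in> ?K \<longleftrightarrow> X - {w} \<in> ?Y"
      proof (cases "X - {w} \<subseteq> V")
        case sub: True
        then show ?thesis using 2[OF sub] True by (simp add: insert_absorb)
      next
        case False
        then show ?thesis by (auto simp: mat_kernel_def)
      qed
      moreover have "X \<in> insert w ` ?Y \<longleftrightarrow> X - {w} \<in> ?Y"
      proof
        assume "X \<in> insert w ` ?Y"
        then obtain Y where Y: "Y \<in> ?Y" "X = insert w Y" by blast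
        then have "X - {w} = Y" using w by auto
        then show "X - {w} \<in> ?Y" using Y(1) by simp
      next
        assume "X - {w} \<in> ?Y"
        then show "X \<in> insert w ` ?Y" using True by (intro image_eqI[of _ _ "X - {w}"]) auto
      qed
      moreover have "X \<notin> ?X" using True w by (auto simp: mat_kernel_def)
      ultimately show ?thesis by blast
    next
      case False
      have "X \<in> ?K \<longleftrightarrow> X \<in> ?X"
      proof (cases "X \<subseteq> V")
        case True
        then show ?thesis by (rule 1)
      next
        case nsub: False
        then show ?thesis using False by (auto simp: mat_kernel_def)
      qed
      then show ?thesis using False by auto
    qed
  qed
  moreover have "finite ?X" "finite ?Y" using finV finite_mat_kernel[OF finV, of S] by auto
  moreover have "?X \<inter> insert w ` ?Y = {}" using w by (auto simp: mat_kernel_def)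
  moreover have "inj_on (insert w) ?Y" using w by (intro inj_onI) (auto simp: insert_ident)
  ultimately show ?thesis by (simp add: card_Un_disjoint card_image)
qed

text \<open>A row outside the image is not orthogonal to the kernel, so it cuts the kernel in half,
  while the inhomogeneous system has no solution.\<close>

lemma card_mat_kernel_add_row_outside:
  assumes N: "N \<subseteq> insert w V" "N - {w} \<notin> mat_image V S ` Pow V"
  shows "2 * card (mat_kernel (insert w V) (add_row w S N)) = card (mat_kernel V S)"
proof -
  have "N - {w} \<subseteq> V" using N(1) by auto
  then obtain X0 where X0: "X0 \<in> mat_kernel V S" "odd (card (X0 \<inter> (N - {w})))"
    using N(2) range_mat_image[OF finV, of S] by auto
  have "X0 \<inter> (N - {w}) = X0 \<inter> N" using X0(1) w by (auto simp: mat_kernel_def)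
  with X0 have odd: "odd (card (X0 \<inter> N))" by simp
  have "2 * card {X \<in> mat_kernel V S. even (card (X \<inter> N))} = card (mat_kernel V S)"
    by (rule card_half_even[OF finite_mat_kernel[OF finV] _ mat_kernel_closed[OF finV] X0(1) odd])
      (use finV in \<open>auto simp: mat_kernel_def intro: finite_subset\<close>)
  moreover have none: "{Y. Y \<subseteq> V \<and> mat_image V S Y = N - {w} \<and> (even (card (Y \<inter> N)) \<longleftrightarrow> w \<notin> N)} = {}"
    using N(2) by blast
  ultimately show ?thesis unfolding card_mat_kernel_add_row[OF N(1)] none by simp
qed

text \<open>A row in the image is orthogonal to the kernel, so every old kernel vector survives. The
  solutions of the inhomogeneous system form a coset of the kernel, which the condition at
  \<open>w\<close> accepts or rejects as a whole.\<close>

lemma card_mat_kernel_add_row_inside: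
  assumes N: "N \<subseteq> insert w V" and Y0: "Y0 \<subseteq> V" "mat_image V S Y0 = N - {w}"
  shows "card (mat_kernel (insert w V) (add_row w S N)) =
    (if even (card (Y0 \<inter> N)) \<longleftrightarrow> w \<notin> N then 2 * card (mat_kernel V S) else card (mat_kernel V S))"
proof -
  have kernel_even: "even (card (X \<inter> N))" if X: "X \<in> mat_kernel V S" for X
  proof -
    have "N - {w} \<in> mat_image V S ` Pow V" using Y0 by (intro image_eqI[of _ _ Y0]) auto
    then have "even (card (X \<inter> (N - {w})))" using X range_mat_image[OF finV, of S] by auto
    moreover have "X \<inter> (N - {w}) = X \<inter> N" using X w by (auto simp: mat_kernel_def)
    ultimately show ?thesis by simp
  qed
  \<comment> \<open>Two solutions differ by a kernel vector, so the parity does not depend on the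
    solution chosen.\<close>
  have same: "even (card (Y \<inter> N)) \<longleftrightarrow> even (card (Y0 \<inter> N))"
    if Y: "Y \<subseteq> V" "mat_image V S Y = N - {w}" for Y
  proof -
    have fin: "finite Y" "finite Y0" using Y Y0 finV by (auto intro: finite_subset)
    have "sym_diff Y Y0 \<in> mat_kernel V S"
      using Y Y0 fin by (auto simp: mat_kernel_def mat_image_sym_diff)
    from kernel_even[OF this] show ?thesis using even_card_sym_diff_Int[OF fin] by blast
  qed
  have X: "{X \<in> mat_kernel V S. even (card (X \<inter> N))} = mat_kernel V S"
    using kernel_even by auto
  have Y: "{Y. Y \<subseteq> V \<and> mat_image V S Y = N - {w} \<and> (even (card (Y \<inter> N)) \<longleftrightarrow> w \<notin> N)} =
      (if even (card (Y0 \<inter> N)) \<longleftrightarrow> w \<notin> N then {Y. Y \<subseteq> V \<and> mat_image V S Y = N - {w}} else {})"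
    using same by auto
  show ?thesis
    unfolding card_mat_kernel_add_row[OF N] X Y using card_mat_fibre[OF finV Y0] by simp
qed

text \<open>The two summands are the two choices of the diagonal entry over the off-diagonal part
  \<open>M\<close>. For \<open>M\<close> in the image, switching that entry flips the parity
  condition, so exactly one choice doubles the kernel; otherwise both choices halve it.\<close>

lemma count_add_row_fixed:
  fixes x :: nat
  assumes M: "M \<subseteq> V"
  defines "c \<equiv> card (mat_kernel V S)"
  shows "(of_bool (card (mat_kernel (insert w V) (add_row w S M)) = x) +
      of_bool (card (mat_kernel (insert w V) (add_row w S (insert w M))) = x) :: real) =
    (if M \<in> mat_image V S ` Pow V then of_bool (2 * c = x) + of_bool (c = x)
     else 2 * of_bool (c = 2 * x))"
proof (cases "M \<in> mat_image V S ` Pow V")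
  case True
  then obtain Y0 where Y0: "Y0 \<subseteq> V" "mat_image V S Y0 = M" by blast
  have M': "M \<subseteq> insert w V" "insert w M \<subseteq> insert w V" "w \<notin> M" using M w by auto
  have i: "M - {w} = M" "insert w M - {w} = M" "Y0 \<inter> insert w M = Y0 \<inter> M"
    using M'(3) Y0(1) w by auto
  have "card (mat_kernel (insert w V) (add_row w S M)) =
      (if even (card (Y0 \<inter> M)) then 2 * c else c)"
    using card_mat_kernel_add_row_inside[OF M'(1) Y0(1)] Y0(2) M'(3) i by (simp add: c_def)
  moreover have "card (mat_kernel (insert w V) (add_row w S (insert w M))) =
      (if even (card (Y0 \<inter> M)) then c else 2 * c)"
    using card_mat_kernel_add_row_inside[OF M'(2) Y0(1)] Y0(2) M'(3) i by (simp add: c_def)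
  ultimately show ?thesis using True by simp
next
  case False
  have M': "M \<subseteq> insert w V" "insert w M \<subseteq> insert w V" "w \<notin> M" using M w by auto
  have i: "M - {w} = M" "insert w M - {w} = M" using M'(3) by auto
  have "2 * card (mat_kernel (insert w V) (add_row w S M)) = c"
    using card_mat_kernel_add_row_outside[OF M'(1)] False i by (simp add: c_def)
  moreover have "2 * card (mat_kernel (insert w V) (add_row w S (insert w M))) = c"
    using card_mat_kernel_add_row_outside[OF M'(2)] False i by (simp add: c_def)
  ultimately have "card (mat_kernel (insert w V) (add_row w S M)) = x \<longleftrightarrow> c = 2 * x"
    "card (mat_kernel (insert w V) (add_row w S (insert w M))) = x \<longleftrightarrow> c = 2 * x"
    by auto
  then show ?thesis using False by simp
qed

lemma count_add_row:
  fixes x :: nat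
  defines "c \<equiv> card (mat_kernel V S)"
  shows "(\<Sum>N\<in>Pow (insert w V). of_bool (card (mat_kernel (insert w V) (add_row w S N)) = x) :: real) =
    2 ^ card V / c * (of_bool (2 * c = x) + of_bool (c = x)) +
    (2 ^ card V - 2 ^ card V / c) * (2 * of_bool (c = 2 * x))"
proof -
  let ?g = "\<lambda>N. of_bool (card (mat_kernel (insert w V) (add_row w S N)) = x) :: real"
  let ?I = "mat_image V S ` Pow V"
  have "c \<noteq> 0" using finite_mat_kernel[OF finV, of S] empty_in_mat_kernel[OF finV, of S] by (auto simp: c_def)
  moreover have "real c * real (card ?I) = 2 ^ card V"
    using card_kernel_times_card_image[OF finV, of S] by (simp add: c_def flip: of_nat_mult)
  ultimately have I: "real (card ?I) = 2 ^ card V / c" by (simp add: field_simps)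
  have IV: "?I \<subseteq> Pow V" by (auto simp: mat_image_def)
  \<comment> \<open>Rows with diagonal entry 0 and 1 are separated and then paired by their common
    off-diagonal part.\<close>
  have "(\<Sum>N\<in>Pow (insert w V). ?g N) = (\<Sum>M\<in>Pow V. ?g M) + (\<Sum>M\<in>insert w ` Pow V. ?g M)"
    unfolding Pow_insert by (rule sum.union_disjoint) (use finV w in auto)
  also have "(\<Sum>M\<in>insert w ` Pow V. ?g M) = (\<Sum>M\<in>Pow V. ?g (insert w M))"
    by (subst sum.reindex) (use w in \<open>auto intro!: inj_onI simp: insert_ident subset_iff\<close>)
  also have "(\<Sum>M\<in>Pow V. ?g M) + \<dots> = (\<Sum>M\<in>Pow V. if M \<in> ?I then of_bool (2 * c = x) + of_bool (c = x)
     else 2 * of_bool (c = 2 * x))"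
    unfolding sum.distrib[symmetric] c_def by (intro sum.cong refl count_add_row_fixed) auto
  also have "\<dots> = (\<Sum>M\<in>?I. of_bool (2 * c = x) + of_bool (c = x)) + (\<Sum>M\<in>Pow V - ?I. 2 * of_bool (c = 2 * x))"
  proof -
    have "Pow V \<inter> {M. M \<in> ?I} = ?I" "Pow V \<inter> - {M. M \<in> ?I} = Pow V - ?I" using IV by auto
    then show ?thesis using finV by (subst sum.If_cases) auto
  qed
  also have "\<dots> = real (card ?I) * (of_bool (2 * c = x) + of_bool (c = x)) + (card (Pow V) - real (card ?I)) * (2 * of_bool (c = 2 * x))"
  proof -
    have "real (card (Pow V - ?I)) = card (Pow V) - real (card ?I)"
      using IV finV card_mono[OF _ IV] by (subst card_Diff_subset) (auto intro: finite_subset simp: of_nat_diff)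
    then show ?thesis by (simp add: sum_constant)
  qed
  finally show ?thesis unfolding I by (simp only: card_Pow[OF finV] of_nat_power of_nat_numeral)
qed

end

section \<open>Counting symmetric matrices by kernel size\<close>

definition num_with_kernel :: "'a set \<Rightarrow> nat \<Rightarrow> real" where
  "num_with_kernel V x = card {S. S \<subseteq> loop_pairs V \<and> card (mat_kernel V S) = x}"

lemma num_with_kernel_eq_sum:
  assumes "finite V"
  shows "num_with_kernel V x = (\<Sum>S\<in>Pow (loop_pairs V). of_bool (card (mat_kernel V S) = x))"
proof -
  have "Pow (loop_pairs V) \<inter> {S. card (mat_kernel V S) = x} =
      {S. S \<subseteq> loop_pairs V \<and> card (mat_kernel V S) = x}" by auto
  then show ?thesis
    using finite_loop_pairs[OF assms] by (simp add: num_with_kernel_def sum_of_bool_eq)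
qed

text \<open>The bordering count is summed over all old matrices; the three terms come from old
  kernels of size \<open>x div 2\<close>, \<open>x\<close> and \<open>2 * x\<close>.\<close>

lemma num_with_kernel_insert:
  assumes finV: "finite V" and w: "w \<notin> V"
  shows "num_with_kernel (insert w V) x =
    (if even x then 2 ^ card V / real (x div 2) * num_with_kernel V (x div 2) else 0) +
    2 ^ card V / x * num_with_kernel V x +
    2 * (2 ^ card V - 2 ^ card V / real (2 * x)) * num_with_kernel V (2 * x)"
proof -
  let ?P = "Pow (loop_pairs V)"
  let ?c = "\<lambda>S. card (mat_kernel V S)"
  let ?m = "2 ^ card V :: real"
  have "num_with_kernel (insert w V) x =
      (\<Sum>(S, N)\<in>?P \<times> Pow (insert w V). of_bool (card (mat_kernel (insert w V) (add_row w S N)) = x))"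
    unfolding num_with_kernel_eq_sum[OF finite.insertI[OF finV]]
    by (subst sum.reindex_bij_betw[OF bij_betw_add_row[OF w], symmetric]) (simp add: case_prod_unfold)
  also have "\<dots> = (\<Sum>S\<in>?P. \<Sum>N\<in>Pow (insert w V). of_bool (card (mat_kernel (insert w V) (add_row w S N)) = x))"
    by (rule sum.cartesian_product[symmetric])
  also have "\<dots> = (\<Sum>S\<in>?P. ?m / ?c S * (of_bool (2 * ?c S = x) + of_bool (?c S = x)) +
      (?m - ?m / ?c S) * (2 * of_bool (?c S = 2 * x)))"
    by (intro sum.cong refl count_add_row[OF finV _ w]) auto
  also have "\<dots> = (\<Sum>S\<in>?P. (if even x then ?m / real (x div 2) * of_bool (?c S = x div 2) else 0) +
      ?m / x * of_bool (?c S = x) + 2 * (?m - ?m / real (2 * x)) * of_bool (?c S = 2 * x))"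
  proof (intro sum.cong refl)
    fix S
    \<comment> \<open>Each indicator fixes \<open>?c S\<close>, so the coefficients can be expressed
      by \<open>x\<close>. The indicators can overlap only at \<open>x = 0\<close>, where division
      by 0 gives 0 on both sides.\<close>
    have "2 * ?c S = x \<longleftrightarrow> even x \<and> ?c S = x div 2" "2 * x = x div 2 \<longleftrightarrow> x = 0" by auto
    then show "?m / ?c S * (of_bool (2 * ?c S = x) + of_bool (?c S = x)) +
        (?m - ?m / ?c S) * (2 * of_bool (?c S = 2 * x)) =
      (if even x then ?m / real (x div 2) * of_bool (?c S = x div 2) else 0) +
      ?m / x * of_bool (?c S = x) + 2 * (?m - ?m / real (2 * x)) * of_bool (?c S = 2 * x)"
      by (simp add: distrib_left)
  qed
  also have "\<dots> = (if even x then ?m / real (x div 2) * num_with_kernel V (x div 2) else 0) +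
    ?m / x * num_with_kernel V x + 2 * (?m - ?m / real (2 * x)) * num_with_kernel V (2 * x)"
    by (simp add: num_with_kernel_eq_sum[OF finV] sum.distrib sum_distrib_left del: sum_of_bool_eq sum_mult_of_bool_eq)
  finally show ?thesis .
qed

section \<open>The product formula and its recursion\<close>

definition euler_prod :: "nat \<Rightarrow> real" where
  "euler_prod s = (\<Prod>i = 1..s. inverse (1 - 1 / 2 ^ (2 * i)))"

text \<open>The conjectural number of symmetric matrices of size \<open>m\<close> and corank
  \<open>k\<close>, verified below; \<open>euler_prod\<close> truncates the Euler product of all 1 /
  (1 - q^i) at q = 1/4. The value 0 for \<open>k > m\<close> lets the recursion hold at the
  boundary.\<close>

definition sym_count :: "nat \<Rightarrow> nat \<Rightarrow> real" where
  "sym_count m k = (if k \<le> m then euler_prod ((m - k) div 2) * (\<Prod>i = k + 1..m. 2 ^ i - 1) else 0)"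

lemma euler_prod_0: "euler_prod 0 = 1"
  by (simp add: euler_prod_def)

lemma euler_prod_Suc: "(2 ^ (2 * Suc s) - 1) * euler_prod (Suc s) = 2 ^ (2 * Suc s) * euler_prod s"
proof -
  have "(2::real) ^ (2 * Suc s) > 1" by (rule one_less_power) auto
  then show ?thesis by (simp add: euler_prod_def field_simps)
qed

text \<open>Two consecutive halves always agree: for even \<open>t\<close> the two products on the
  right coincide, for odd \<open>t\<close> the left one equals the first on the right. Either way
  \<open>euler_prod_Suc\<close> remains.\<close>

lemma euler_prod_step:
  "(2 ^ (t + 2) - 1) * euler_prod ((t + 2) div 2) =
    2 ^ (t + 1) * euler_prod ((t + 1) div 2) + 2 ^ (t + 1) * euler_prod (t div 2)"
proof (cases "even t")
  case True
  then obtain s where t: "t = 2 * s" by (elim evenE)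
  have e: "2 * s + 2 = 2 * Suc s" "2 ^ (2 * Suc s) = 2 * (2::real) ^ (2 * s + 1)" by simp_all
  show ?thesis using euler_prod_Suc[of s] unfolding t e by simp
next
  case False
  then obtain s where t: "t = 2 * s + 1" by (elim oddE)
  have "(2 * s + 1 + 2) div 2 = Suc s" "(2 * s + 1 + 1) div 2 = Suc s" "(2 * s + 1) div 2 = s" by simp_all
  then show ?thesis using euler_prod_Suc[of s] unfolding t by (simp add: algebra_simps)
qed

lemma sym_count_Suc:
  "sym_count (Suc m) k =
    (if k = 0 then 0 else 2 ^ m / 2 ^ (k - 1) * sym_count m (k - 1)) +
    2 ^ m / 2 ^ k * sym_count m k +
    2 * (2 ^ m - 2 ^ m / 2 ^ (k + 1)) * sym_count m (k + 1)"
proof -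
  consider (gt) "k > Suc m" | (eq) "k = Suc m" | (le) "k \<le> m" by linarith
  then show ?thesis
  proof cases
    case gt
    then show ?thesis by (simp add: sym_count_def)
  next
    case eq
    then show ?thesis by (simp add: sym_count_def)
  next
    case le
    then obtain t where m: "m = k + t" using le_Suc_ex by blast
    \<comment> \<open>\<open>Q\<close> is a common factor of all terms; cancelling it leaves an
      identity between values of \<open>euler_prod\<close>.\<close>
    define Q :: real where "Q = (\<Prod>i = k + 1..m. 2 ^ i - 1)"
    \<comment> \<open>The factor \<open>2 ^ k - 1\<close> vanishes at \<open>k = 0\<close>, which
      absorbs the case distinction.\<close>
    have first: "(if k = 0 then 0 else 2 ^ m / 2 ^ (k - 1) * sym_count m (k - 1)) =
        2 ^ (t + 1) * (2 ^ k - 1) * euler_prod ((t + 1) div 2) * Q"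
    proof (cases k)
      case (Suc j)
      have "(\<Prod>i = j + 1..m. 2 ^ i - 1) = (2 ^ k - 1) * Q"
        unfolding Q_def using le Suc by (simp add: prod.atLeast_Suc_atMost)
      moreover have "m - j = t + 1" "(2::real) ^ m / 2 ^ j = 2 ^ (t + 1)" "j \<le> m"
        using m Suc by (simp_all add: power_add)
      ultimately show ?thesis using Suc by (simp add: sym_count_def)
    qed simp
    have second: "2 ^ m / 2 ^ k * sym_count m k = 2 ^ t * euler_prod (t div 2) * Q"
      using m by (simp add: sym_count_def Q_def power_add)
    have lhs: "sym_count (Suc m) k = (2 ^ (Suc m) - 1) * euler_prod ((t + 1) div 2) * Q"
      using m by (simp add: sym_count_def Q_def Suc_diff_le)
    \<comment> \<open>The first summand matches \<open>first\<close>; the remaining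
      \<open>2 ^ (t + 1) - 1\<close> must account for the other two terms, which is
      \<open>euler_prod_step\<close> when \<open>t > 0\<close>.\<close>
    have split: "(2::real) ^ Suc m - 1 = 2 ^ (t + 1) * (2 ^ k - 1) + (2 ^ (t + 1) - 1)"
      by (simp add: m power_add algebra_simps)
    show ?thesis
    proof (cases t)
      case 0
      have "sym_count m (k + 1) = 0" using m 0 by (simp add: sym_count_def)
      then show ?thesis unfolding first second lhs split by (simp add: 0 euler_prod_0 algebra_simps)
    next
      case (Suc r)
      have pos: "(2::real) ^ (k + 1) > 1" by (rule one_less_power) auto
      have "Q = (2 ^ (k + 1) - 1) * (\<Prod>i = (k + 1) + 1..m. 2 ^ i - 1)"
        unfolding Q_def using m Suc by (simp add: prod.atLeast_Suc_atMost)
      moreover have "sym_count m (k + 1) = euler_prod (r div 2) * (\<Prod>i = (k + 1) + 1..m. 2 ^ i - 1)"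
        using m Suc by (simp add: sym_count_def)
      moreover have "2 * (2 ^ m - 2 ^ m / 2 ^ (k + 1)) = 2 ^ t * ((2::real) ^ (k + 1) - 1)"
        by (simp add: m power_add field_simps)
      ultimately have third: "2 * (2 ^ m - 2 ^ m / 2 ^ (k + 1)) * sym_count m (k + 1) =
          2 ^ t * euler_prod (r div 2) * Q"
        by simp
      have "(2 ^ (t + 1) - 1) * euler_prod ((t + 1) div 2) =
          2 ^ t * euler_prod (t div 2) + 2 ^ t * euler_prod (r div 2)"
        using euler_prod_step[of r] Suc by simp
      then have "(2 ^ (t + 1) - 1) * euler_prod ((t + 1) div 2) * Q =
          2 ^ t * euler_prod (t div 2) * Q + 2 ^ t * euler_prod (r div 2) * Q"
        by (simp only: distrib_right)
      then show ?thesis unfolding first second third lhs split by (simp only: distrib_right add.assoc)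
    qed
  qed
qed

text \<open>Both sides obey the same recursion in the matrix size and agree for the empty
  matrix.\<close>

lemma num_with_kernel_eq_sym_count:
  assumes "finite V"
  shows "num_with_kernel V (2 ^ k) = sym_count (card V) k"
  using assms
proof (induction V arbitrary: k)
  case empty
  have "mat_kernel {} S = {{}}" for S :: "'a edges" by (auto simp: mat_kernel_def mat_image_def)
  then have "{S. S \<subseteq> loop_pairs ({} :: 'a set) \<and> card (mat_kernel {} S) = 2 ^ k} = (if k = 0 then {{}} else {})"
    using one_less_power[of "2::nat" k] by (cases "k = 0") (auto simp: loop_pairs_def)
  then show ?case by (simp add: num_with_kernel_def sym_count_def euler_prod_0)
next
  case (insert w V)
  \<comment> \<open>Among powers of 2 only \<open>2 ^ 0\<close> is odd, so the parity test becomes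
    the test \<open>k = 0\<close>.\<close>
  have half: "(if even (2 ^ k :: nat) then 2 ^ card V / real (2 ^ k div 2) * num_with_kernel V (2 ^ k div 2) else 0) =
      (if k = 0 then 0 else 2 ^ card V / 2 ^ (k - 1) * num_with_kernel V (2 ^ (k - 1)))"
    by (cases k) auto
  have step: "num_with_kernel (insert w V) (2 ^ k) =
      (if k = 0 then 0 else 2 ^ card V / 2 ^ (k - 1) * num_with_kernel V (2 ^ (k - 1))) +
      2 ^ card V / 2 ^ k * num_with_kernel V (2 ^ k) +
      2 * (2 ^ card V - 2 ^ card V / 2 ^ (k + 1)) * num_with_kernel V (2 ^ (k + 1))"
    using num_with_kernel_insert[OF insert.hyps, of "2 ^ k"] unfolding half
    by (simp only: of_nat_power of_nat_numeral of_nat_mult power_Suc[symmetric] Suc_eq_plus1)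
  show ?case
    unfolding step insert.IH card_insert_disjoint[OF insert.hyps] by (rule sym_count_Suc[symmetric])
qed

section \<open>From even partitions of graphs to kernels of reduced Laplacians\<close>

lemma card_all_pairs: "finite U \<Longrightarrow> card (all_pairs U) = card U choose 2"
  by (simp add: all_pairs_def n_subsets)

lemma finite_all_pairs: "finite U \<Longrightarrow> finite (all_pairs U)"
  by (rule finite_subset[of _ "Pow U"]) (auto simp: all_pairs_def)

lemma induces_even_iff:
  assumes E: "E \<subseteq> all_pairs U"
  shows "induces_even E A \<longleftrightarrow> (\<forall>v\<in>A. even (card (A \<inter> nbhd E v)))"
proof -
  have "degree_in (induced_edges E A) v = card (A \<inter> nbhd E v)" if v: "v \<in> A" for v
  proof -
    have "{e \<in> induced_edges E A. v \<in> e} = (\<lambda>u. {u, v}) ` (A \<inter> nbhd E v)"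
    proof
      show "{e \<in> induced_edges E A. v \<in> e} \<subseteq> (\<lambda>u. {u, v}) ` (A \<inter> nbhd E v)"
      proof
        fix e assume e: "e \<in> {e \<in> induced_edges E A. v \<in> e}"
        then have "card e = 2" using E by (auto simp: induced_edges_def all_pairs_def)
        then obtain u where "e = {u, v}" using e by (auto simp: card_2_iff)
        then show "e \<in> (\<lambda>u. {u, v}) ` (A \<inter> nbhd E v)"
          using e by (auto simp: induced_edges_def nbhd_def)
      qed
    qed (use v in \<open>auto simp: induced_edges_def nbhd_def\<close>)
    moreover have "inj_on (\<lambda>u. {u, v}) (A \<inter> nbhd E v)"
      by (auto intro!: inj_onI simp: doubleton_eq_iff)
    ultimately show ?thesis by (simp add: degree_in_def card_image)
  qed
  then show ?thesis by (simp add: induces_even_def)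
qed

text \<open>The Laplacian modulo 2 with the row and column of \<open>w\<close> deleted. Its rows and columns sum to 0,
  so nothing is lost, and the edges at \<open>w\<close> make the diagonal arbitrary.\<close>

definition laplacian :: "'a set \<Rightarrow> 'a \<Rightarrow> 'a edges \<Rightarrow> 'a edges" where
  "laplacian V w E = {e \<in> E. w \<notin> e} \<union> (\<lambda>v. {v}) ` {v \<in> V. odd (card (insert w V \<inter> nbhd E v))}"

context
  fixes V :: "'a set" and w :: 'a
  assumes finV: "finite V" and w: "w \<notin> V"
begin

lemma singleton_in_laplacian:
  assumes "E \<subseteq> all_pairs (insert w V)"
  shows "{v} \<in> laplacian V w E \<longleftrightarrow> v \<in> V \<and> odd (card (insert w V \<inter> nbhd E v))"
proof -
  have "{v} \<notin> E" using assms by (auto simp: all_pairs_def)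
  then show ?thesis unfolding laplacian_def by blast
qed

lemma doubleton_in_laplacian:
  assumes "u \<noteq> v"
  shows "{u, v} \<in> laplacian V w E \<longleftrightarrow> {u, v} \<in> E \<and> w \<noteq> u \<and> w \<noteq> v"
proof -
  have "{u, v} \<notin> range (\<lambda>x. {x})" using assms by auto
  then show ?thesis unfolding laplacian_def by blast
qed

text \<open>Off-diagonal entries recover the edges avoiding \<open>w\<close>. Given these, the
  degree parity of \<open>v\<close> on the diagonal reveals whether \<open>{w, v}\<close> is an
  edge.\<close>

lemma inj_on_laplacian: "inj_on (laplacian V w) (Pow (all_pairs (insert w V)))"
proof -
  have "E \<subseteq> E'" if E: "E \<subseteq> all_pairs (insert w V)" and E': "E' \<subseteq> all_pairs (insert w V)"
    and eq: "laplacian V w E = laplacian V w E'" for E E'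
  proof
    have pair: "{u, v} \<in> E \<longleftrightarrow> {u, v} \<in> E'" if "u \<noteq> w" "v \<noteq> w" for u v
    proof (cases "u = v")
      case True
      then show ?thesis using E E' by (auto simp: all_pairs_def)
    next
      case False
      then show ?thesis using doubleton_in_laplacian[OF False] eq that by blast
    qed
    fix e assume e: "e \<in> E"
    then have e2: "e \<subseteq> insert w V" "card e = 2" using E by (auto simp: all_pairs_def)
    then obtain a b where ab: "e = {a, b}" "a \<noteq> b" unfolding card_2_iff by blast
    show "e \<in> E'"
    proof (cases "w \<in> e")
      case False
      then have "a \<noteq> w" "b \<noteq> w" using ab by auto
      then show ?thesis using pair[of a b] e unfolding ab by blast
    next
      case True
      define v where "v = (if w = a then b else a)"
      have v: "v \<in> V" "e = {w, v}" using True ab e2(1) by (auto simp: v_def)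
      have nb: "V \<inter> nbhd E v = V \<inter> nbhd E' v"
      proof -
        have "u \<in> nbhd E v \<longleftrightarrow> u \<in> nbhd E' v" if "u \<in> V" for u
        proof -
          have "u \<noteq> w" "v \<noteq> w" using that v(1) w by auto
          then show ?thesis using pair unfolding nbhd_def by simp
        qed
        then show ?thesis by blast
      qed
      have c: "card (insert w V \<inter> nbhd F v) = card (V \<inter> nbhd F v) + of_bool ({w, v} \<in> F)" for F
        using finV w by (auto simp: Int_insert_left nbhd_def)
      have "odd (card (insert w V \<inter> nbhd E v)) \<longleftrightarrow> odd (card (insert w V \<inter> nbhd E' v))"
        using singleton_in_laplacian[OF E, of v] singleton_in_laplacian[OF E', of v] eq v(1) by simp
      then have "{w, v} \<in> E \<longleftrightarrow> {w, v} \<in> E'" unfolding c nb by simp blast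
      then show ?thesis using e unfolding v(2) by blast
    qed
  qed
  then show ?thesis by (intro inj_onI subset_antisym) auto
qed

text \<open>Injectivity suffices because both sides have equal size. This turns a uniform graph into
  a uniform symmetric matrix.\<close>

lemma bij_betw_laplacian:
  "bij_betw (laplacian V w) (Pow (all_pairs (insert w V))) (Pow (loop_pairs V))"
proof -
  have "laplacian V w ` Pow (all_pairs (insert w V)) \<subseteq> Pow (loop_pairs V)"
    by (auto simp: laplacian_def all_pairs_def loop_pairs_def)
  moreover have "card (loop_pairs V) = card (all_pairs (insert w V))"
  proof -
    have "loop_pairs V = {e. e \<subseteq> V \<and> card e = 1} \<union> {e. e \<subseteq> V \<and> card e = 2}"
      by (auto simp: loop_pairs_def)
    also have "card \<dots> = card {e. e \<subseteq> V \<and> card e = 1} + card {e. e \<subseteq> V \<and> card e = 2}"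
      using finV by (intro card_Un_disjoint) auto
    \<comment> \<open>Pascal's rule.\<close>
    also have "\<dots> = Suc (card V) choose 2"
      using finV by (simp add: n_subsets numeral_2_eq_2)
    finally show ?thesis using finV w by (simp add: card_all_pairs)
  qed
  then have "card (Pow (loop_pairs V)) = card (laplacian V w ` Pow (all_pairs (insert w V)))"
    using finV by (simp add: card_image[OF inj_on_laplacian] card_Pow finite_loop_pairs finite_all_pairs)
  ultimately have "laplacian V w ` Pow (all_pairs (insert w V)) = Pow (loop_pairs V)"
    using finV by (intro card_subset_eq) (auto simp: finite_loop_pairs)
  then show ?thesis using inj_on_laplacian by (simp add: bij_betw_def)
qed

text \<open>The condition at \<open>w\<close> is implied by those at \<open>V\<close> because the degree sum of the part
  containing \<open>w\<close> is even.\<close>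
lemma even_partition_iff:
  assumes E: "E \<subseteq> all_pairs (insert w V)" and A: "A \<subseteq> V"
  shows "induces_even E A \<and> induces_even E (insert w V - A) \<longleftrightarrow>
    mat_image V (laplacian V w E) A = loops V (laplacian V w E)"
proof -
  let ?B = "insert w V - A"
  have fA: "finite A" and fB: "finite ?B" using A finV by (auto intro: finite_subset)
  have noloop: "v \<notin> nbhd E v" for v using E by (auto simp: nbhd_def all_pairs_def)
  have deg: "card (insert w V \<inter> nbhd E v) = card (A \<inter> nbhd E v) + card (?B \<inter> nbhd E v)" for v
  proof -
    have "insert w V \<inter> nbhd E v = (A \<inter> nbhd E v) \<union> (?B \<inter> nbhd E v)" using A by auto
    then show ?thesis using fA fB by (simp only:) (intro card_Un_disjoint; auto)
  qed
  have nb: "A \<inter> nbhd (laplacian V w E) v =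
      (if v \<in> A \<and> odd (card (insert w V \<inter> nbhd E v)) then insert v (A \<inter> nbhd E v) else A \<inter> nbhd E v)"
    if v: "v \<in> V" for v
  proof -
    have "u \<in> nbhd (laplacian V w E) v \<longleftrightarrow>
        u \<in> nbhd E v \<or> (u = v \<and> odd (card (insert w V \<inter> nbhd E v)))" if "u \<in> A" for u
    proof (cases "u = v")
      case True
      then show ?thesis
        using v noloop[of v] singleton_in_laplacian[OF E, of v] by (simp add: nbhd_def)
    next
      case False
      moreover have "w \<noteq> u" "w \<noteq> v" using that v A w by auto
      ultimately show ?thesis using doubleton_in_laplacian[OF False] by (simp add: nbhd_def)
    qed
    then show ?thesis by auto
  qed
  \<comment> \<open>For \<open>v\<close> in \<open>A\<close> the diagonal adds the degree of
    \<open>v\<close> to both sides, leaving the degree within \<open>A\<close>. For \<open>v\<close>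
    outside \<open>A\<close> the degree into \<open>A\<close> is compared with the full degree,
    leaving the degree within \<open>?B\<close>.\<close>
  have at_v: "(odd (card (A \<inter> nbhd (laplacian V w E) v)) \<longleftrightarrow> odd (card (insert w V \<inter> nbhd E v))) \<longleftrightarrow>
      (if v \<in> A then even (card (A \<inter> nbhd E v)) else even (card (?B \<inter> nbhd E v)))" if "v \<in> V" for v
    using nb[OF that] noloop[of v] fA deg[of v] by auto
  have "mat_image V (laplacian V w E) A = loops V (laplacian V w E) \<longleftrightarrow>
      (\<forall>v\<in>V. odd (card (A \<inter> nbhd (laplacian V w E) v)) \<longleftrightarrow> odd (card (insert w V \<inter> nbhd E v)))"
    using singleton_in_laplacian[OF E] by (auto simp: mat_image_def loops_def)
  also have "\<dots> \<longleftrightarrow> (\<forall>v\<in>A. even (card (A \<inter> nbhd E v))) \<and> (\<forall>v\<in>V - A. even (card (?B \<inter> nbhd E v)))"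
  proof -
    have "(\<forall>v\<in>V. P v) \<longleftrightarrow> (\<forall>v\<in>A. Q v) \<and> (\<forall>v\<in>V - A. R v)"
      if "\<And>v. v \<in> V \<Longrightarrow> P v \<longleftrightarrow> (if v \<in> A then Q v else R v)" for P Q R
      using that A by (metis Diff_iff subset_iff)
    from this[OF at_v] show ?thesis .
  qed
  also have "(\<forall>v\<in>V - A. even (card (?B \<inter> nbhd E v))) \<longleftrightarrow> (\<forall>v\<in>?B. even (card (?B \<inter> nbhd E v)))"
  proof
    assume *: "\<forall>v\<in>V - A. even (card (?B \<inter> nbhd E v))"
    have "loops ?B E = {}" using noloop by (auto simp: loops_def nbhd_def)
    then have "even (\<Sum>v\<in>?B. card (?B \<inter> nbhd E v))" using even_sum_card_nbhd[OF fB, of E] by simp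
    moreover have B: "?B = insert w (V - A)" using A w by auto
    moreover have "(\<Sum>v\<in>insert w (V - A). card (?B \<inter> nbhd E v)) =
        card (?B \<inter> nbhd E w) + (\<Sum>v\<in>V - A. card (?B \<inter> nbhd E v))"
      using finV w by (intro sum.insert) auto
    moreover have "even (\<Sum>v\<in>V - A. card (?B \<inter> nbhd E v))" using * by (intro dvd_sum) auto
    ultimately have "even (card (?B \<inter> nbhd E w))" by (metis even_add)
    then show "\<forall>v\<in>?B. even (card (?B \<inter> nbhd E v))" using * by blast
  qed auto
  finally show ?thesis unfolding induces_even_iff[OF E] by blast
qed

text \<open>Each unordered partition is represented by its part avoiding \<open>w\<close>. These
  parts are the solutions of the diagonal system, and \<open>card_solutions_loops\<close> counts
  them by the kernel.\<close>

lemma num_even_partitions_eq: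
  assumes E: "E \<subseteq> all_pairs (insert w V)"
  shows "num_even_partitions (insert w V) E = card (mat_kernel V (laplacian V w E))"
proof -
  let ?Y = "{Y. Y \<subseteq> V \<and> mat_image V (laplacian V w E) Y = loops V (laplacian V w E)}"
  have "even_partitions (insert w V) E = (\<lambda>A. {A, insert w V - A}) ` ?Y"
  proof
    show "even_partitions (insert w V) E \<subseteq> (\<lambda>A. {A, insert w V - A}) ` ?Y"
    proof
      fix P assume "P \<in> even_partitions (insert w V) E"
      then obtain A B where AB: "P = {A, B}" "A \<union> B = insert w V" "A \<inter> B = {}"
        "induces_even E A" "induces_even E B"
        unfolding even_partitions_def by blast
      have B: "B = insert w V - A" and A: "A = insert w V - B" using AB(2,3) by blast+
      show "P \<in> (\<lambda>A. {A, insert w V - A}) ` ?Y"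
      proof (cases "w \<in> A")
        case False
        then have sub: "A \<subseteq> V" using AB(2) by auto
        then have "A \<in> ?Y" using even_partition_iff[OF E sub] AB(4,5) B by simp
        then show ?thesis using AB(1) B by blast
      next
        case True
        then have sub: "B \<subseteq> V" using AB(2,3) by auto
        then have "B \<in> ?Y" using even_partition_iff[OF E sub] AB(4,5) A by simp
        moreover have "P = {B, insert w V - B}" using AB(1) A by (simp add: insert_commute)
        ultimately show ?thesis by blast
      qed
    qed
    show "(\<lambda>A. {A, insert w V - A}) ` ?Y \<subseteq> even_partitions (insert w V) E"
    proof
      fix P assume "P \<in> (\<lambda>A. {A, insert w V - A}) ` ?Y"
      then obtain A where A: "A \<in> ?Y" "P = {A, insert w V - A}" by blast
      then have "induces_even E A \<and> induces_even E (insert w V - A)"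
        using even_partition_iff[OF E, of A] by simp
      moreover have "A \<union> (insert w V - A) = insert w V" "A \<inter> (insert w V - A) = {}" using A(1) by auto
      ultimately show "P \<in> even_partitions (insert w V) E"
        unfolding even_partitions_def using A(2) by blast
    qed
  qed
  \<comment> \<open>Exactly one of the two parts avoids \<open>w\<close>, so the pair determines
    \<open>A\<close>.\<close>
  moreover have "inj_on (\<lambda>A. {A, insert w V - A}) ?Y"
    using w by (intro inj_onI) (auto simp: doubleton_eq_iff)
  ultimately show ?thesis
    by (simp add: num_even_partitions_def card_image card_solutions_loops[OF finV])
qed

lemma card_num_even_partitions_eq:
  "real (card {E \<in> Pow (all_pairs (insert w V)). num_even_partitions (insert w V) E = x}) =
    num_with_kernel V x"
proof -
  have "bij_betw (laplacian V w) {E \<in> Pow (all_pairs (insert w V)). num_even_partitions (insert w V) E = x}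
      {S \<in> Pow (loop_pairs V). card (mat_kernel V S) = x}"
    using bij_betw_laplacian by (rule bij_betw_Collect) (simp add: num_even_partitions_eq)
  from bij_betw_same_card[OF this] show ?thesis by (simp add: num_with_kernel_def)
qed

end

section \<open>Transfer to the random graph\<close>

theorem theorem5p3:
  fixes n :: nat
  assumes "n \<ge> 1"
  shows "(\<forall>k\<le>n - 1.
            measure_pmf.prob (binomial_random_graph n (1/2))
              {E. num_even_partitions {1..n} E = 2 ^ k}
            = 1 / 2 ^ (n choose 2)
              * (\<Prod>i = 1..(n - 1 - k) div 2. inverse (1 - 1 / 2 ^ (2 * i)))
              * (\<Prod>i = k + 1..n - 1. 2 ^ i - 1))
       \<and> (\<forall>x::nat. (\<forall>k\<le>n - 1. x \<noteq> 2 ^ k) \<longrightarrow>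
            measure_pmf.prob (binomial_random_graph n (1/2))
              {E. num_even_partitions {1..n} E = x} = 0)"
proof -
  \<comment> \<open>The deleted vertex is \<open>n\<close>, so the matrices have size
    \<open>n - 1\<close>.\<close>
  have n: "{1..n} = insert n {1..n - 1}" "n \<notin> {1..n - 1}" using assms by auto
  have fin: "finite (all_pairs {1..n})" by (rule finite_all_pairs) simp
  \<comment> \<open>At edge probability 1/2 the edge set is uniform on all subsets of
    \<open>all_pairs {1..n}\<close>, so probabilities are counts divided by
    \<open>2 ^ (n choose 2)\<close>.\<close>
  have prob: "measure_pmf.prob (binomial_random_graph n (1/2)) {E. num_even_partitions {1..n} E = x}
      = num_with_kernel {1..n - 1} x / 2 ^ (n choose 2)" for x
  proof -
    have "Pow (all_pairs {1..n}) \<inter> {E. num_even_partitions {1..n} E = x} =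
        {E \<in> Pow (all_pairs {1..n}). num_even_partitions {1..n} E = x}" by auto
    moreover have "real (card {E \<in> Pow (all_pairs {1..n}). num_even_partitions {1..n} E = x}) =
        num_with_kernel {1..n - 1} x"
      unfolding n(1) by (rule card_num_even_partitions_eq) (use n(2) in auto)
    ultimately show ?thesis
      unfolding binomial_random_graph_def pmf_of_set_Pow_conv_bernoulli[OF fin]
      using fin by (subst measure_pmf_of_set) (auto simp: card_Pow card_all_pairs)
  qed
  \<comment> \<open>Kernel sizes are powers of 2 with exponent at most \<open>n - 1\<close>, so no
    matrix attains any other value.\<close>
  have "num_with_kernel {1..n - 1} x = 0" if x: "\<forall>k\<le>n - 1. x \<noteq> 2 ^ k" for x
  proof -
    have "card (mat_kernel {1..n - 1} S) \<noteq> x" for S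
      by (rule card_mat_kernel_power_of_2[of "{1..n - 1}" S]) (use x in auto)
    then show ?thesis by (simp add: num_with_kernel_def)
  qed
  then show ?thesis
    unfolding prob by (simp add: num_with_kernel_eq_sym_count sym_count_def euler_prod_def)
qed

end
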